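(* Let $X$ be a set and let $(X,\bullet)\in ZBin(X)$. Then for all $x,y\in X$ with $x\neq y$ one has $\{x,y\}=\{x\bullet y,\;y\bullet x\}$.
   Context: A groupoid (binary system) on a set $X$ is a pair $(X,\ast)$ where $\ast:X\times X\to X$ is an arbitrary binary operation. $Bin(X)$ denotes the set of all groupoids on $X$. For $(X,\ast),(X,\bullet)\in Bin(X)$ the product is $(X,\ast)\,\Box\,(X,\bullet)=(X,\Box)$, where $x\,\Box\,y:=(x\ast y)\bullet(y\ast x)$ for all $x,y\in X$. This makes $(Bin(X),\Box)$ a semigroup. The center $ZBin(X)$ is the set of all $(X,\bullet)\in Bin(X)$ such that $(X,\ast)\,\Box\,(X,\bullet)=(X,\bullet)\,\Box\,(X,\ast)$ for every $(X,\ast)\in Bin(X)$. *)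

theory Defs
  imports "HOL-Library.FuncSet"
begin

text \<open>A groupoid on \<open>X\<close> is represented by its operation, a curried function that is
  extensional on the carrier (value \<open>undefined\<close> outside \<open>X\<close>). Hence HOL equality of two
  elements of \<open>Bin X\<close> is equality of the two operations on \<open>X \<times> X\<close>.\<close>

definition Bin :: "'a set \<Rightarrow> ('a \<Rightarrow> 'a \<Rightarrow> 'a) set" where
  "Bin X = X \<rightarrow>\<^sub>E (X \<rightarrow>\<^sub>E X)"

definition bin_prod :: "'a set \<Rightarrow> ('a \<Rightarrow> 'a \<Rightarrow> 'a) \<Rightarrow> ('a \<Rightarrow> 'a \<Rightarrow> 'a) \<Rightarrow> ('a \<Rightarrow> 'a \<Rightarrow> 'a)" where
  "bin_prod X f g = (\<lambda>x\<in>X. \<lambda>y\<in>X. g (f x y) (f y x))"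

definition ZBin :: "'a set \<Rightarrow> ('a \<Rightarrow> 'a \<Rightarrow> 'a) set" where
  "ZBin X = {g \<in> Bin X. \<forall>f \<in> Bin X. bin_prod X f g = bin_prod X g f}"

lemma bin_prod_in_Bin: "f \<in> Bin X \<Longrightarrow> g \<in> Bin X \<Longrightarrow> bin_prod X f g \<in> Bin X"
  unfolding Bin_def bin_prod_def by (intro restrict_PiE_iff[THEN iffD2] ballI) (meson PiE_mem)

lemma bin_prod_assoc:
  assumes "f \<in> Bin X" "g \<in> Bin X" "h \<in> Bin X"
  shows "bin_prod X (bin_prod X f g) h = bin_prod X f (bin_prod X g h)"
proof -
  have "f x y \<in> X" if "x \<in> X" "y \<in> X" for x y
    using assms(1) that unfolding Bin_def by (meson PiE_mem)
  then show ?thesis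
    by (auto simp: bin_prod_def restrict_def fun_eq_iff)
qed

end

theory Submission
  imports Defs
begin

text \<open>A central \<open>g\<close> commutes with every operation, so well-chosen test operations
  reveal its values. Constant operations force \<open>g\<close> to be idempotent
  (\<open>ZBin_idem\<close>). A two-valued operation that detects the unordered pair
  \<open>{x, y}\<close> then forces \<open>g x y\<close> and \<open>g y x\<close> to form that same
  pair.\<close>

lemma ZBin_commute:
  assumes "g \<in> ZBin X" and "\<And>u v. f u v \<in> X" and "x \<in> X" "y \<in> X"
  shows "g (f x y) (f y x) = f (g x y) (g y x)"
proof -
  \<comment> \<open>Elements of \<open>Bin X\<close> are extensional; restricting here lets test
    operations be given as plain total functions.\<close>
  define f' where "f' = (\<lambda>u\<in>X. \<lambda>v\<in>X. f u v)"
  have "g \<in> X \<rightarrow>\<^sub>E X \<rightarrow>\<^sub>E X"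
    using assms(1) by (simp add: ZBin_def Bin_def)
  then have "g x y \<in> X" "g y x \<in> X"
    using assms(3,4) by (blast dest: PiE_mem)+
  moreover have "f' \<in> Bin X"
    unfolding f'_def Bin_def using assms(2) by auto
  then have "bin_prod X f' g x y = bin_prod X g f' x y"
    using assms(1) by (simp add: ZBin_def)
  ultimately show ?thesis
    using assms(3,4) by (simp add: bin_prod_def f'_def)
qed

text \<open>Commuting with the constant operation \<open>x\<close> gives this: one product is
  \<open>g x x\<close>, the other is \<open>x\<close>.\<close>

lemma ZBin_idem:
  assumes "g \<in> ZBin X" and "x \<in> X"
  shows "g x x = x"
  using ZBin_commute[of g X "\<lambda>_ _. x" x x] assms by simp

theorem theorem2p3:
  fixes X :: "'a set" and g :: "'a \<Rightarrow> 'a \<Rightarrow> 'a"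
  assumes "g \<in> ZBin X"
  shows "\<forall>x\<in>X. \<forall>y\<in>X. x \<noteq> y \<longrightarrow> {x, y} = {g x y, g y x}"
proof (intro ballI impI)
  fix x y assume xy: "x \<in> X" "y \<in> X" "x \<noteq> y"
  \<comment> \<open>\<open>f\<close> is a symmetric indicator of the pair \<open>{x, y}\<close>:
    both \<open>f x y\<close> and \<open>f y x\<close> are \<open>x\<close>, so one side of the
    commutation collapses to \<open>g x x = x\<close>.\<close>
  define f where "f u v = (if {u, v} = {x, y} then x else y)" for u v
  have "g (f x y) (f y x) = f (g x y) (g y x)"
    using assms xy by (intro ZBin_commute) (auto simp: f_def)
  then have "f (g x y) (g y x) = x"
    using ZBin_idem[OF assms xy(1)] by (simp add: f_def insert_commute)
  then show "{x, y} = {g x y, g y x}"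
    \<comment> \<open>As \<open>x \<noteq> y\<close>, the value \<open>x\<close> rules out the else
      branch.\<close>
    using xy(3) by (auto simp: f_def split: if_splits)
qed

end
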